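(* Let $\mathcal{Z}$ be an imprecise continuous-time hidden Markov chain, built from an ICTMC $\mathbb{P}_{\mathcal{Q},\mathcal{M}}$ and an output model $(\mathcal{Y},\Sigma,P_{\mathcal{Y}|\mathcal{X}})$, and consider any $u,v\in\mathcal{U}$, $O_u\in\Sigma_u$ and $f\in\mathcal{L}(\mathcal{X}_v)$. If $\overline{P}_{\mathcal{Z}}(Y_u\in O_u)=\overline{\mathbb{E}}_{\mathcal{Q},\mathcal{M}}[P_{\mathcal{Y}|\mathcal{X}}(O_u\mid X_u)]>0$, then the updated lower expectation $$\underline{\mathbb{E}}_{\mathcal{Z}}[f(X_v)\mid Y_u\in O_u]=\inf\bigl\{\mathbb{E}_P[f(X_v)\mid Y_u\in O_u]: P\in\mathcal{Z},\ P(Y_u\in O_u)>0\bigr\}$$ satisfies $$\underline{\mathbb{E}}_{\mathcal{Z}}[f(X_v)\mid Y_u\in O_u]=\max\bigl\{\mu\in\mathbb{R}:\ \underline{\mathbb{E}}_{\mathcal{Q},\mathcal{M}}\bigl[P_{\mathcal{Y}|\mathcal{X}}(O_u\mid X_u)\bigl(f(X_v)-\mu\bigr)\bigr]\ge 0\bigr\}.$$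
   Context: $\mathcal{X}$ is a fixed non-empty finite set (the state space). $\mathcal{U}$ is the set of all non-empty finite sets $u\subset\mathbb{R}_{\ge 0}$ (viewed as increasingly ordered sequences of time points). For $u\in\mathcal{U}$, $\mathcal{X}_u=\prod_{t\in u}\mathcal{X}$ with generic element $x_u=(x_t)_{t\in u}$, and $\mathcal{L}(\mathcal{X}_u)$ is the set of real-valued functions on $\mathcal{X}_u$. The sets $u,v$ may overlap; a product such as $g(X_u)f(X_v)$ is a function of $X_{u\cup v}$. Stochastic processes. Let $\Omega$ be the set of all functions $\omega:\mathbb{R}_{\ge 0}\to\mathcal{X}$ and $X_t(\omega)=\omega(t)$. A continuous-time stochastic process $P_{\mathcal{X}}$ assigns a number $P_{\mathcal{X}}(A\mid X_u=x_u)$ to every finite, possibly empty, $u\subset\mathbb{R}_{\ge0}$, every $x_u\in\mathcal{X}_u$ and every $A$ in the algebra generated by the events $(X_s=x)$, $x\in\mathcal{X}$, with $s\in u$ or $s$ larger than all elements of $u$, in such a way that it extends to a full conditional probability on $\Omega$, i.e. a map $(A,C)\mapsto P(A\mid C)$ defined for all $A\subseteq\Omega$ and $\emptyset\ne C\subseteq\Omega$ with: $P(A\mid C)\ge 0$; $P(A\mid C)=1$ if $C\subseteq A$; $P(A\cup B\mid C)=P(A\mid C)+P(B\mid C)$ if $A\cap B=\emptyset$; $P(A\cap D\mid C)=P(A\mid D\cap C)P(D\mid C)$ if $D\cap C\neq\emptyset$. For $u=\emptyset$ one writes $P_{\mathcal{X}}(A)$, and $\mathbb{E}_{P_{\mathcal{X}}}[h(X_w)]=\sum_{x_w\in\mathcal{X}_w}h(x_w)P_{\mathcal{X}}(X_w=x_w)$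 for $w\in\mathcal{U}$, $h\in\mathcal{L}(\mathcal{X}_w)$. ICTMC. A rate matrix is a real $|\mathcal{X}|\times|\mathcal{X}|$ matrix with non-negative off-diagonal entries and rows summing to zero. Standing assumptions: $\mathcal{M}$ is a non-empty set of probability mass functions on $\mathcal{X}$; $\mathcal{Q}$ is a non-empty, convex set of rate matrices that is bounded (there is $c\ge 0$ with $|Q(x,x)|<c$ for all $Q\in\mathcal{Q}$, $x\in\mathcal{X}$) and has separately specified rows (every rate matrix $Q$, such that for each $x$ there is $Q'\in\mathcal{Q}$ with $Q(x,\cdot)=Q'(x,\cdot)$, belongs to $\mathcal{Q}$). For a process $P_{\mathcal{X}}$, times $t\le s$, and a (possibly empty) finite history $x_u$ with all elements of $u$ smaller than $t$, let $T_{t,x_u}^s(x,y)=P_{\mathcal{X}}(X_s=y\mid X_t=x,X_u=x_u)$. $P_{\mathcal{X}}$ is well-behaved if for all such $t,x_u$ the matrices $\frac1\Delta(T_{t,x_u}^{t+\Delta}-I)$ and (for $t>0$) $\frac1\Delta(T_{t-\Delta,x_u}^{t}-I)$ remain bounded as $\Delta\to0^+$; it is consistent with $\mathcal{Q}$ if all limit points of these matrices as $\Delta\to0^+$ belong to $\mathcal{Q}$. The imprecise continuous-time Markov chain (ICTMC) $\mathbb{P}_{\mathcal{Q},\mathcal{M}}$ is the set of all well-behaved processes consistent with $\mathcal{Q}$ whose initial mass function $P_{\mathcal{X}}(X_0=\cdot)$ belongs to $\mathcal{M}$. Define $\underline{\mathbb{E}}_{\mathcal{Q},\mathcal{M}}[\cdot]=\inf\{\mathbb{E}_{P_{\mathcal{X}}}[\cdot]:P_{\mathcal{X}}\in\mathbb{P}_{\mathcal{Q},\mathcal{M}}\}$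 and $\overline{\mathbb{E}}_{\mathcal{Q},\mathcal{M}}[\cdot]=-\underline{\mathbb{E}}_{\mathcal{Q},\mathcal{M}}[-\,\cdot\,]$. Output model. A tuple $(\mathcal{Y},\Sigma,P_{\mathcal{Y}|\mathcal{X}})$ with $\mathcal{Y}$ a set, $\Sigma$ an algebra on $\mathcal{Y}$ and, for each $x\in\mathcal{X}$, $P_{\mathcal{Y}|\mathcal{X}}(\cdot\mid x)$ a finitely additive probability measure on $(\mathcal{Y},\Sigma)$. $\Sigma_u$ is the set of products $O_u=\times_{t\in u}O_t$ with all $O_t\in\Sigma$, and $P_{\mathcal{Y}|\mathcal{X}}(O_u\mid x_u)=\prod_{t\in u}P_{\mathcal{Y}|\mathcal{X}}(O_t\mid x_t)$. Augmented process. $P=P_{\mathcal{Y}|\mathcal{X}}\otimes P_{\mathcal{X}}$ has joint probabilities $P(Y_u\in O_u,X_u=x_u,X_w=x_w)=P_{\mathcal{Y}|\mathcal{X}}(O_u\mid x_u)P_{\mathcal{X}}(X_u=x_u,X_w=x_w)$ for $u\cap w=\emptyset$, other probabilities being obtained by marginalisation. The imprecise continuous-time hidden Markov chain (ICTHMC) is $\mathcal{Z}=\{P_{\mathcal{Y}|\mathcal{X}}\otimes P_{\mathcal{X}}:P_{\mathcal{X}}\in\mathbb{P}_{\mathcal{Q},\mathcal{M}}\}$, and $\overline{P}_{\mathcal{Z}}(Y_u\in O_u)=\sup_{P\in\mathcal{Z}}P(Y_u\in O_u)$. For $P\in\mathcal{Z}$ with $P(Y_u\in O_u)>0$, $\mathbb{E}_P[f(X_v)\mid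 Y_u\in O_u]=\sum_{x_v\in\mathcal{X}_v}f(x_v)\frac{P(X_v=x_v,Y_u\in O_u)}{P(Y_u\in O_u)}$. *)

theory Defs
  imports "HOL-Analysis.Analysis" "HOL-Probability.Probability_Mass_Function"
begin

text \<open>
  The state space is a finite type \<open>'x\<close>.  Time points are non-negative reals; a path and a state
  assignment \<open>x\<^sub>u\<close> are extensional functions on \<open>{0..}\<close> and on \<open>u\<close> respectively, so that
  \<open>restrict x v\<close> turns an element of \<open>assignments (u \<union> v)\<close> into its \<open>v\<close>-component.
\<close>

definition time_sets :: "real set set" where
  "time_sets = {u. finite u \<and> u \<noteq> {} \<and> u \<subseteq> {0..}}"

definition assignments :: "real set \<Rightarrow> (real \<Rightarrow> 'x) set" where
  "assignments u = (u \<rightarrow>\<^sub>E UNIV)"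

definition paths :: "(real \<Rightarrow> 'x) set" where
  "paths = ({0..} \<rightarrow>\<^sub>E UNIV)"

text \<open>The event \<open>X\<^sub>u = x\<^sub>u\<close>.\<close>

definition state_event :: "real set \<Rightarrow> (real \<Rightarrow> 'x) \<Rightarrow> (real \<Rightarrow> 'x) set" where
  "state_event u x = {\<omega> \<in> paths. \<forall>t\<in>u. \<omega> t = x t}"

definition event_algebra :: "real set \<Rightarrow> (real \<Rightarrow> 'x) set set" where
  "event_algebra u = algebra paths hull
     {{\<omega> \<in> paths. \<omega> s = x} | s x. 0 \<le> s \<and> (s \<in> u \<or> (\<forall>t\<in>u. t < s))}"

definition full_conditional_probability ::
  "((real \<Rightarrow> 'x) set \<Rightarrow> (real \<Rightarrow> 'x) set \<Rightarrow> real) \<Rightarrow> bool" where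
  "full_conditional_probability P \<longleftrightarrow>
     (\<forall>A C. A \<subseteq> paths \<and> C \<subseteq> paths \<and> C \<noteq> {} \<longrightarrow> P A C \<ge> 0) \<and>
     (\<forall>A C. A \<subseteq> paths \<and> C \<subseteq> paths \<and> C \<noteq> {} \<and> C \<subseteq> A \<longrightarrow> P A C = 1) \<and>
     (\<forall>A B C. A \<subseteq> paths \<and> B \<subseteq> paths \<and> C \<subseteq> paths \<and> C \<noteq> {} \<and> A \<inter> B = {} \<longrightarrow>
        P (A \<union> B) C = P A C + P B C) \<and>
     (\<forall>A D C. A \<subseteq> paths \<and> D \<subseteq> paths \<and> C \<subseteq> paths \<and> D \<inter> C \<noteq> {} \<longrightarrow>
        P (A \<inter> D) C = P A (D \<inter> C) * P D C)"

text \<open>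
  \<open>P A C\<close> is \<open>P(A | C)\<close>.  A process is a partial function; its values at pairs \<open>(A, C)\<close> other than
  those below are unconstrained and are never used.  Unconditional probabilities have
  \<open>C = state_event {} x = paths\<close>.
\<close>

definition stochastic_process ::
  "((real \<Rightarrow> 'x) set \<Rightarrow> (real \<Rightarrow> 'x) set \<Rightarrow> real) \<Rightarrow> bool" where
  "stochastic_process P \<longleftrightarrow>
     (\<exists>P'. full_conditional_probability P' \<and>
        (\<forall>u. finite u \<and> u \<subseteq> {0..} \<longrightarrow>
           (\<forall>x\<in>assignments u. \<forall>A\<in>event_algebra u.
              P A (state_event u x) = P' A (state_event u x))))"

definition expectation ::
  "((real \<Rightarrow> 'x::finite) set \<Rightarrow> (real \<Rightarrow> 'x) set \<Rightarrow> real) \<Rightarrow> real set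
     \<Rightarrow> ((real \<Rightarrow> 'x) \<Rightarrow> real) \<Rightarrow> real" where
  "expectation P w h = (\<Sum>x\<in>assignments w. h x * P (state_event w x) paths)"

definition rate_matrix :: "real^'x^'x \<Rightarrow> bool" where
  "rate_matrix Q \<longleftrightarrow>
     (\<forall>x y. x \<noteq> y \<longrightarrow> Q $ x $ y \<ge> 0) \<and> (\<forall>x. (\<Sum>y\<in>UNIV. Q $ x $ y) = 0)"

definition bounded_rates :: "(real^'x^'x) set \<Rightarrow> bool" where
  "bounded_rates \<Q> \<longleftrightarrow> (\<exists>c\<ge>0. \<forall>Q\<in>\<Q>. \<forall>x. \<bar>Q $ x $ x\<bar> < c)"

definition separately_specified_rows :: "(real^'x^'x) set \<Rightarrow> bool" where
  "separately_specified_rows \<Q> \<longleftrightarrow>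
     (\<forall>Q. rate_matrix Q \<and> (\<forall>x. \<exists>Q'\<in>\<Q>. Q $ x = Q' $ x) \<longrightarrow> Q \<in> \<Q>)"

text \<open>\<open>transition P u z t s\<close> is the matrix \<open>T\<close> from time \<open>t\<close> to time \<open>s\<close> given the history \<open>X\<^sub>u = z\<close>.\<close>

definition transition ::
  "((real \<Rightarrow> 'x) set \<Rightarrow> (real \<Rightarrow> 'x) set \<Rightarrow> real) \<Rightarrow> real set \<Rightarrow> (real \<Rightarrow> 'x)
     \<Rightarrow> real \<Rightarrow> real \<Rightarrow> real^'x^'x" where
  "transition P u z t s =
     (\<chi> x y. P {\<omega> \<in> paths. \<omega> s = y} (state_event (insert t u) (z(t := x))))"

definition right_quotient ::
  "((real \<Rightarrow> 'x::finite) set \<Rightarrow> (real \<Rightarrow> 'x) set \<Rightarrow> real) \<Rightarrow> real set \<Rightarrow> (real \<Rightarrow> 'x)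
     \<Rightarrow> real \<Rightarrow> real \<Rightarrow> real^'x^'x" where
  "right_quotient P u z t \<Delta> = (1 / \<Delta>) *\<^sub>R (transition P u z t (t + \<Delta>) - mat 1)"

definition left_quotient ::
  "((real \<Rightarrow> 'x::finite) set \<Rightarrow> (real \<Rightarrow> 'x) set \<Rightarrow> real) \<Rightarrow> real set \<Rightarrow> (real \<Rightarrow> 'x)
     \<Rightarrow> real \<Rightarrow> real \<Rightarrow> real^'x^'x" where
  "left_quotient P u z t \<Delta> = (1 / \<Delta>) *\<^sub>R (transition P u z (t - \<Delta>) t - mat 1)"

definition limit_points_right :: "(real \<Rightarrow> 'a::topological_space) \<Rightarrow> 'a set" where
  "limit_points_right F =
     {L. \<exists>d::nat \<Rightarrow> real. (\<forall>n. d n > 0) \<and> d \<longlonglongrightarrow> 0 \<and> (\<lambda>n. F (d n)) \<longlonglongrightarrow> L}"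

definition well_behaved ::
  "((real \<Rightarrow> 'x::finite) set \<Rightarrow> (real \<Rightarrow> 'x) set \<Rightarrow> real) \<Rightarrow> bool" where
  "well_behaved P \<longleftrightarrow>
     (\<forall>t\<ge>0. \<forall>u. finite u \<and> u \<subseteq> {0..<t} \<longrightarrow> (\<forall>z\<in>assignments u.
        Bfun (right_quotient P u z t) (at_right 0) \<and>
        (t > 0 \<longrightarrow> Bfun (left_quotient P u z t) (at_right 0))))"

definition consistent ::
  "(real^'x^'x) set \<Rightarrow> ((real \<Rightarrow> 'x::finite) set \<Rightarrow> (real \<Rightarrow> 'x) set \<Rightarrow> real) \<Rightarrow> bool" where
  "consistent \<Q> P \<longleftrightarrow>
     (\<forall>t\<ge>0. \<forall>u. finite u \<and> u \<subseteq> {0..<t} \<longrightarrow> (\<forall>z\<in>assignments u.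
        limit_points_right (right_quotient P u z t) \<subseteq> \<Q> \<and>
        (t > 0 \<longrightarrow> limit_points_right (left_quotient P u z t) \<subseteq> \<Q>)))"

definition ictmc ::
  "(real^'x^'x) set \<Rightarrow> 'x pmf set
     \<Rightarrow> ((real \<Rightarrow> 'x::finite) set \<Rightarrow> (real \<Rightarrow> 'x) set \<Rightarrow> real) set" where
  "ictmc \<Q> \<M> =
     {P. stochastic_process P \<and> well_behaved P \<and> consistent \<Q> P \<and>
         (\<exists>p\<in>\<M>. \<forall>x. P {\<omega> \<in> paths. \<omega> 0 = x} paths = pmf p x)}"

text \<open>Infima and suprema are taken in the extended reals.\<close>

definition lower_expectation ::
  "(real^'x^'x) set \<Rightarrow> 'x::finite pmf set \<Rightarrow> real set \<Rightarrow> ((real \<Rightarrow> 'x) \<Rightarrow> real) \<Rightarrow> ereal" where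
  "lower_expectation \<Q> \<M> w h = (INF P\<in>ictmc \<Q> \<M>. ereal (expectation P w h))"

definition upper_expectation ::
  "(real^'x^'x) set \<Rightarrow> 'x::finite pmf set \<Rightarrow> real set \<Rightarrow> ((real \<Rightarrow> 'x) \<Rightarrow> real) \<Rightarrow> ereal" where
  "upper_expectation \<Q> \<M> w h = - lower_expectation \<Q> \<M> w (\<lambda>x. - h x)"

definition output_model :: "'y set \<Rightarrow> 'y set set \<Rightarrow> ('x \<Rightarrow> 'y set \<Rightarrow> real) \<Rightarrow> bool" where
  "output_model Y \<Sigma> K \<longleftrightarrow>
     algebra Y \<Sigma> \<and>
     (\<forall>x. (\<forall>A\<in>\<Sigma>. K x A \<ge> 0) \<and> K x Y = 1 \<and>
          (\<forall>A\<in>\<Sigma>. \<forall>B\<in>\<Sigma>. A \<inter> B = {} \<longrightarrow> K x (A \<union> B) = K x A + K x B))"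

text \<open>A product \<open>\<times>\<^sub>t\<^sub>\<in>\<^sub>u B\<^sub>t\<close> is represented by the family \<open>B\<close> of its factors.\<close>

definition output_prob ::
  "('x \<Rightarrow> 'y set \<Rightarrow> real) \<Rightarrow> real set \<Rightarrow> (real \<Rightarrow> 'y set) \<Rightarrow> (real \<Rightarrow> 'x) \<Rightarrow> real" where
  "output_prob K u B x = (\<Prod>t\<in>u. K (x t) (B t))"

text \<open>
  An augmented process is given by the probabilities \<open>R u B w z = P(Y\<^sub>u \<in> B\<^sub>u, X\<^sub>w = z)\<close> for arbitrary
  finite, possibly overlapping or empty, \<open>u\<close> and \<open>w\<close>.  For \<open>w \<supseteq> u\<close> this is the defining joint
  probability; for other \<open>w\<close> it is the marginal of the joint probability on \<open>u \<union> w\<close>.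
\<close>

definition augment ::
  "('x \<Rightarrow> 'y set \<Rightarrow> real) \<Rightarrow> ((real \<Rightarrow> 'x::finite) set \<Rightarrow> (real \<Rightarrow> 'x) set \<Rightarrow> real)
     \<Rightarrow> real set \<Rightarrow> (real \<Rightarrow> 'y set) \<Rightarrow> real set \<Rightarrow> (real \<Rightarrow> 'x) \<Rightarrow> real" where
  "augment K P u B w z =
     (\<Sum>x | x \<in> assignments (u \<union> w) \<and> restrict x w = z.
        output_prob K u B (restrict x u) * P (state_event (u \<union> w) x) paths)"

definition icthmc ::
  "(real^'x^'x) set \<Rightarrow> 'x::finite pmf set \<Rightarrow> ('x \<Rightarrow> 'y set \<Rightarrow> real)
     \<Rightarrow> (real set \<Rightarrow> (real \<Rightarrow> 'y set) \<Rightarrow> real set \<Rightarrow> (real \<Rightarrow> 'x) \<Rightarrow> real) set" where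
  "icthmc \<Q> \<M> K = augment K ` ictmc \<Q> \<M>"

text \<open>\<open>P(Y\<^sub>u \<in> B\<^sub>u)\<close>; the only element of \<open>assignments {}\<close> is \<open>\<lambda>_. undefined\<close>.\<close>

definition prob_output ::
  "(real set \<Rightarrow> (real \<Rightarrow> 'y set) \<Rightarrow> real set \<Rightarrow> (real \<Rightarrow> 'x) \<Rightarrow> real)
     \<Rightarrow> real set \<Rightarrow> (real \<Rightarrow> 'y set) \<Rightarrow> real" where
  "prob_output R u B = R u B {} (\<lambda>_. undefined)"

definition upper_prob_output ::
  "(real set \<Rightarrow> (real \<Rightarrow> 'y set) \<Rightarrow> real set \<Rightarrow> (real \<Rightarrow> 'x) \<Rightarrow> real) set
     \<Rightarrow> real set \<Rightarrow> (real \<Rightarrow> 'y set) \<Rightarrow> ereal" where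
  "upper_prob_output Z u B = (SUP R\<in>Z. ereal (prob_output R u B))"

definition updated_expectation ::
  "(real set \<Rightarrow> (real \<Rightarrow> 'y set) \<Rightarrow> real set \<Rightarrow> (real \<Rightarrow> 'x::finite) \<Rightarrow> real)
     \<Rightarrow> real set \<Rightarrow> ((real \<Rightarrow> 'x) \<Rightarrow> real) \<Rightarrow> real set \<Rightarrow> (real \<Rightarrow> 'y set) \<Rightarrow> real" where
  "updated_expectation R v f u B =
     (\<Sum>x\<in>assignments v. f x * (R u B v x / prob_output R u B))"

definition updated_lower_expectation ::
  "(real set \<Rightarrow> (real \<Rightarrow> 'y set) \<Rightarrow> real set \<Rightarrow> (real \<Rightarrow> 'x::finite) \<Rightarrow> real) set
     \<Rightarrow> real set \<Rightarrow> ((real \<Rightarrow> 'x) \<Rightarrow> real) \<Rightarrow> real set \<Rightarrow> (real \<Rightarrow> 'y set) \<Rightarrow> ereal" where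
  "updated_lower_expectation Z v f u B =
     (INF R\<in>{R \<in> Z. prob_output R u B > 0}. ereal (updated_expectation R v f u B))"

definition is_max :: "real set \<Rightarrow> real \<Rightarrow> bool" where
  "is_max S m \<longleftrightarrow> m \<in> S \<and> (\<forall>\<mu>\<in>S. \<mu> \<le> m)"

lemma augment_joint:
  assumes "x \<in> assignments (u \<union> w)"
  shows "augment K P u B (u \<union> w) x =
           output_prob K u B (restrict x u) * P (state_event (u \<union> w) x) paths"
proof -
  have "{y. y \<in> assignments (u \<union> w) \<and> restrict y (u \<union> w) = x} = {x}"
    using assms unfolding assignments_def by (auto simp: PiE_restrict)
  then show ?thesis
    by (simp add: augment_def sup.left_idem)
qed

lemma augment_marginal:
  "augment K P u B w z =
     (\<Sum>x | x \<in> assignments (u \<union> w) \<and> restrict x w = z. augment K P u B (u \<union> w) x)"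
  unfolding augment_def[of K P u B w z]
  by (rule sum.cong) (auto simp: augment_joint)

lemma prob_output_augment:
  "prob_output (augment K P) u B = expectation P u (output_prob K u B)"
proof -
  have "{x. x \<in> assignments (u \<union> {}) \<and> restrict x {} = (\<lambda>_. undefined)} = assignments u"
    by auto
  then show ?thesis
    unfolding prob_output_def augment_def expectation_def
    by (simp, intro sum.cong) (auto simp: assignments_def PiE_restrict)
qed

lemma upper_prob_output_eq_upper_expectation:
  "upper_prob_output (icthmc \<Q> \<M> K) u B = upper_expectation \<Q> \<M> u (output_prob K u B)"
proof -
  have "expectation P u (\<lambda>x. - output_prob K u B x) = - expectation P u (output_prob K u B)" for P
    by (simp add: expectation_def sum_negf)
  then show ?thesis
    unfolding upper_prob_output_def upper_expectation_def lower_expectation_def icthmc_def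
    by (simp add: image_image prob_output_augment ereal_INF_uminus_eq
             flip: uminus_ereal.simps(1))
qed

end

(*
  For a process P put p = E_P[g] and n = E_P[g f], where g is the likelihood of the observation.  The
  expectation of g (f - mu) is n - mu p.  If p = 0, nonnegativity of g forces n = 0, so the constraint
  n - mu p >= 0 only restricts mu through the processes with p > 0, where it reads mu <= n / p, i.e.
  mu is a lower bound of the updated expectations.  The set of lower bounds has a maximum because f
  is bounded below and some p is positive.
*)
theory Submission
  imports Defs
begin

lemma finite_assignments: "finite u \<Longrightarrow> finite (assignments u :: (real \<Rightarrow> 'x::finite) set)"
  unfolding assignments_def by (auto intro: finite_PiE)

lemma paths_nonempty: "(paths :: (real \<Rightarrow> 'x) set) \<noteq> {}"
  unfolding paths_def by (simp add: PiE_eq_empty_iff)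

lemma state_event_subset_paths: "state_event w x \<subseteq> paths"
  by (auto simp: state_event_def)

text \<open>With an empty history the condition on later times is vacuous, so every coordinate event
  at a time \<open>s \<ge> 0\<close> is a generator; the state event is a finite intersection of
  such generators. This places it among the events on which a process is constrained.\<close>

lemma state_event_in_event_algebra:
  assumes "finite w" "w \<subseteq> {0..}"
  shows "state_event w x \<in> event_algebra {}"
  unfolding event_algebra_def hull_def
proof (rule InterI, clarify)
  fix T :: "(real \<Rightarrow> 'a) set set"
  assume alg: "algebra paths T"
    and gen: "{{\<omega> \<in> paths. \<omega> s = x} |s x. 0 \<le> s \<and> (s \<in> {} \<or> (\<forall>t\<in>{}. t < s))} \<subseteq> T"
  interpret algebra paths T by (rule alg)
  show "state_event w x \<in> T"
    using assms
  proof (induction w rule: finite_induct)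
    case empty
    then show ?case by (simp add: state_event_def)
  next
    case (insert s w)
    have "{\<omega> \<in> paths. \<omega> s = x s} \<in> T" using gen insert.prems by blast
    moreover have "state_event (insert s w) x = {\<omega> \<in> paths. \<omega> s = x s} \<inter> state_event w x"
      by (auto simp: state_event_def)
    ultimately show ?case using insert by auto
  qed
qed

lemma full_conditional_probability_sum:
  assumes "full_conditional_probability P" "C \<subseteq> paths" "C \<noteq> {}"
    and "finite I" "\<forall>i\<in>I. A i \<subseteq> paths" "disjoint_family_on A I"
  shows "P (\<Union>i\<in>I. A i) C = (\<Sum>i\<in>I. P (A i) C)"
  using assms(4-)
proof (induction I rule: finite_induct)
  have add: "P (A \<union> B) C = P A C + P B C" if "A \<subseteq> paths" "B \<subseteq> paths" "A \<inter> B = {}" for A B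
    using assms(1-3) that unfolding full_conditional_probability_def by blast
  {
    case empty
    \<comment> \<open>Additivity at two empty sets reads \<open>P {} C = P {} C + P {} C\<close>, so
      this value is zero.\<close>
    then show ?case using add[of "{}" "{}"] by simp
  next
    case (insert i I)
    have "A i \<inter> (\<Union>j\<in>I. A j) = {}"
      using insert.prems insert.hyps by (fastforce simp: disjoint_family_on_def)
    moreover have "disjoint_family_on A I"
      using insert.prems by (auto simp: disjoint_family_on_def)
    ultimately show ?case
      using insert add[of "A i" "\<Union>j\<in>I. A j"] by (simp add: UN_subset_iff)
  }
qed

text \<open>A process itself need not be additive or non-negative at arbitrary pairs. The laws of
  probability are therefore applied to an extension \<open>P'\<close> and carried back along this
  agreement on state events given \<open>paths\<close>.\<close>

lemma stochastic_process_unconditional: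
  assumes "stochastic_process P"
  obtains P' where "full_conditional_probability P'"
    and "\<And>w x. finite w \<Longrightarrow> w \<subseteq> {0..} \<Longrightarrow> P (state_event w x) paths = P' (state_event w x) paths"
proof -
  obtain P' where P': "full_conditional_probability P'"
    and eq: "\<forall>u. finite u \<and> u \<subseteq> {0..} \<longrightarrow>
      (\<forall>x\<in>assignments u. \<forall>A\<in>event_algebra u. P A (state_event u x) = P' A (state_event u x))"
    using assms unfolding stochastic_process_def by blast
  \<comment> \<open>The only assignment on the empty time set; its state event is all of
    \<open>paths\<close>, which turns conditional values into unconditional ones.\<close>
  define z where "z = (\<lambda>_::real. undefined :: 'a)"
  have "z \<in> assignments {}" "state_event {} z = paths"
    by (auto simp: z_def assignments_def state_event_def)
  then have "P A paths = P' A paths" if "A \<in> event_algebra {}" for A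
    using eq[rule_format, of "{}" z A] that by simp
  with P' show thesis
    by (intro that[of P']) (auto intro: state_event_in_event_algebra)
qed

lemma stochastic_process_nonneg:
  assumes "stochastic_process P" "finite w" "w \<subseteq> {0..}"
  shows "P (state_event w x) paths \<ge> 0"
proof -
  obtain P' where P': "full_conditional_probability P'"
    and eq: "\<And>w x. finite w \<Longrightarrow> w \<subseteq> {0..} \<Longrightarrow> P (state_event w x) paths = P' (state_event w x) paths"
    using stochastic_process_unconditional[OF assms(1)] by blast
  have "P' (state_event w x) paths \<ge> 0"
    by (rule P'[unfolded full_conditional_probability_def, THEN conjunct1, rule_format])
      (simp add: paths_nonempty state_event_subset_paths)
  then show ?thesis using eq[OF assms(2,3)] by simp
qed

lemma state_event_split:
  assumes "u \<subseteq> w" "w \<subseteq> {0..}" "z \<in> assignments u"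
  shows "state_event u z = (\<Union>x\<in>{x \<in> assignments w. restrict x u = z}. state_event w x)"
proof
  show "state_event u z \<subseteq> (\<Union>x\<in>{x \<in> assignments w. restrict x u = z}. state_event w x)"
  proof
    fix \<omega> assume \<omega>: "\<omega> \<in> state_event u z"
    \<comment> \<open>An equality of functions: off \<open>u\<close> both sides are
      \<open>undefined\<close>, since \<open>z\<close> is extensional.\<close>
    then have "restrict \<omega> u = z"
      using assms(3) by (auto simp: state_event_def assignments_def restrict_def PiE_def extensional_def)
    then have "restrict \<omega> w \<in> {x \<in> assignments w. restrict x u = z}"
      using assms(1) by (auto simp: assignments_def Int_absorb1)
    moreover have "\<omega> \<in> state_event w (restrict \<omega> w)"
      using \<omega> by (auto simp: state_event_def)
    ultimately show "\<omega> \<in> (\<Union>x\<in>{x \<in> assignments w. restrict x u = z}. state_event w x)"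
      by blast
  qed
qed (use assms(1) in \<open>auto simp: state_event_def\<close>)

lemma state_event_disjoint:
  "disjoint_family_on (state_event w) (assignments w)"
  unfolding disjoint_family_on_def
proof (intro ballI impI)
  fix x y :: "real \<Rightarrow> 'a"
  assume "x \<in> assignments w" "y \<in> assignments w" "x \<noteq> y"
  then obtain t where "t \<in> w" "x t \<noteq> y t"
    unfolding assignments_def by (meson PiE_ext)
  then show "state_event w x \<inter> state_event w y = {}"
    by (auto simp: state_event_def)
qed

text \<open>The event at \<open>u\<close> is the disjoint union of the events at \<open>w\<close>
  that refine it, and the extension \<open>P'\<close> is finitely additive.\<close>

lemma state_event_marginal:
  fixes P :: "(real \<Rightarrow> 'x::finite) set \<Rightarrow> (real \<Rightarrow> 'x) set \<Rightarrow> real"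
  assumes "stochastic_process P" "finite w" "w \<subseteq> {0..}" "u \<subseteq> w" "z \<in> assignments u"
  shows "P (state_event u z) paths =
    (\<Sum>x | x \<in> assignments w \<and> restrict x u = z. P (state_event w x) paths)"
proof -
  obtain P' where P': "full_conditional_probability P'"
    and eq: "\<And>w x. finite w \<Longrightarrow> w \<subseteq> {0..} \<Longrightarrow> P (state_event w x) paths = P' (state_event w x) paths"
    using stochastic_process_unconditional[OF assms(1)] by blast
  have "disjoint_family_on (state_event w) {x \<in> assignments w. restrict x u = z}"
    using state_event_disjoint by (rule disjoint_family_on_mono[rotated]) auto
  then have "P' (state_event u z) paths =
      (\<Sum>x | x \<in> assignments w \<and> restrict x u = z. P' (state_event w x) paths)"
    unfolding state_event_split[OF assms(4,3,5)]
    using P' assms(2) paths_nonempty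
    by (intro full_conditional_probability_sum)
      (auto simp: finite_assignments intro: state_event_subset_paths[THEN subsetD])
  moreover have "finite u" "u \<subseteq> {0..}"
    using assms(2-4) finite_subset by auto
  ultimately show ?thesis using eq assms(2,3) by simp
qed

lemma restrict_image_assignments: "(\<lambda>x. restrict x u) ` assignments w \<subseteq> assignments u"
  by (auto simp: assignments_def)

text \<open>Grouping the assignments on \<open>w\<close> by their restriction to \<open>u\<close>
  reduces this to marginals. It lets the probability of the observation, a sum over
  \<open>u\<close>, be computed on the common time set \<open>u \<union> v\<close>.\<close>

lemma expectation_restrict:
  fixes P :: "(real \<Rightarrow> 'x::finite) set \<Rightarrow> (real \<Rightarrow> 'x) set \<Rightarrow> real"
  assumes "stochastic_process P" "finite w" "w \<subseteq> {0..}" "u \<subseteq> w"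
  shows "expectation P w (\<lambda>x. h (restrict x u)) = expectation P u h"
proof -
  have "expectation P u h = (\<Sum>z\<in>assignments u.
      \<Sum>x | x \<in> assignments w \<and> restrict x u = z. h (restrict x u) * P (state_event w x) paths)"
    unfolding expectation_def
    by (intro sum.cong) (simp_all add: state_event_marginal[OF assms] sum_distrib_left)
  also have "\<dots> = expectation P w (\<lambda>x. h (restrict x u))"
    unfolding expectation_def using assms(2,4)
    by (intro sum.group finite_assignments restrict_image_assignments) (auto intro: finite_subset)
  finally show ?thesis ..
qed

text \<open>Each \<open>augment K P u B v z\<close> sums over the fibre of restriction to
  \<open>v\<close> above \<open>z\<close>, where \<open>f z\<close> equals
  \<open>f (restrict x v)\<close>; the fibres together exhaust
  \<open>assignments (u \<union> v)\<close>.\<close>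

lemma sum_augment:
  assumes "finite u" "finite v"
  shows "(\<Sum>z\<in>assignments v. f z * augment K P u B v z) =
    expectation P (u \<union> v) (\<lambda>x. output_prob K u B (restrict x u) * f (restrict x v))"
proof -
  have "(\<Sum>z\<in>assignments v. f z * augment K P u B v z) =
    (\<Sum>z\<in>assignments v. \<Sum>x | x \<in> assignments (u \<union> v) \<and> restrict x v = z.
      output_prob K u B (restrict x u) * f (restrict x v) * P (state_event (u \<union> v) x) paths)"
    unfolding augment_def sum_distrib_left by (intro sum.cong) auto
  also have "\<dots> = expectation P (u \<union> v) (\<lambda>x. output_prob K u B (restrict x u) * f (restrict x v))"
    unfolding expectation_def using assms
    by (intro sum.group finite_assignments restrict_image_assignments) auto
  finally show ?thesis .
qed

lemma updated_expectation_augment: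
  assumes "finite u" "finite v"
  shows "updated_expectation (augment K P) v f u B =
    expectation P (u \<union> v) (\<lambda>x. output_prob K u B (restrict x u) * f (restrict x v)) /
    prob_output (augment K P) u B"
  unfolding updated_expectation_def sum_augment[OF assms, symmetric] by (simp add: sum_divide_distrib)

lemma expectation_diff_scaled:
  "expectation P w (\<lambda>x. g x * (h x - \<mu>)) = expectation P w (\<lambda>x. g x * h x) - \<mu> * expectation P w g"
  by (simp add: expectation_def sum_distrib_left sum_subtractf[symmetric] algebra_simps)

text \<open>A vanishing sum of non-negative terms has only zero terms, and the factor
  \<open>h x\<close> cannot revive them. This settles processes that give the observation
  probability zero.\<close>

lemma expectation_eq_0_mult:
  assumes "finite w" "\<And>x. g x \<ge> 0" "\<And>x. P (state_event w x) paths \<ge> 0" "expectation P w g = 0"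
  shows "expectation P w (\<lambda>x. g x * h x) = 0"
proof -
  have "\<forall>x\<in>assignments w. g x * P (state_event w x) paths = 0"
    using assms unfolding expectation_def by (subst (asm) sum_nonneg_eq_0_iff) (auto simp: finite_assignments)
  then show ?thesis
    unfolding expectation_def by (intro sum.neutral) auto
qed

text \<open>The integrand \<open>g x * (h x - c)\<close> is non-negative on the assignments. With
  \<open>c\<close> the minimum of \<open>f\<close>, this keeps the infimum of the updated
  expectations away from minus infinity.\<close>

lemma expectation_mult_ge:
  assumes "\<And>x. g x \<ge> 0" "\<And>x. P (state_event w x) paths \<ge> 0" "\<And>x. x \<in> assignments w \<Longrightarrow> c \<le> h x"
  shows "c * expectation P w g \<le> expectation P w (\<lambda>x. g x * h x)"
proof -
  have "0 \<le> expectation P w (\<lambda>x. g x * (h x - c))"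
    using assms unfolding expectation_def by (intro sum_nonneg) auto
  then show ?thesis by (simp add: expectation_diff_scaled)
qed

lemma output_prob_nonneg:
  assumes "output_model Y \<Sigma> K" "\<forall>t\<in>u. B t \<in> \<Sigma>"
  shows "output_prob K u B x \<ge> 0"
  using assms unfolding output_model_def output_prob_def by (auto intro: prod_nonneg)

theorem proposition5:
  fixes \<Q> :: "(real^'x^'x) set" and \<M> :: "'x::finite pmf set"
    and Y :: "'y set" and \<Sigma> :: "'y set set" and K :: "'x \<Rightarrow> 'y set \<Rightarrow> real"
    and u v :: "real set" and B :: "real \<Rightarrow> 'y set" and f :: "(real \<Rightarrow> 'x) \<Rightarrow> real"
  assumes "\<M> \<noteq> {}"
    and "\<Q> \<noteq> {}" and "\<forall>Q\<in>\<Q>. rate_matrix Q" and "convex \<Q>"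
    and "bounded_rates \<Q>" and "separately_specified_rows \<Q>"
    and "output_model Y \<Sigma> K"
    and "u \<in> time_sets" and "v \<in> time_sets"
    and "\<forall>t\<in>u. B t \<in> \<Sigma>"
    and "upper_prob_output (icthmc \<Q> \<M> K) u B > 0"
  shows "\<exists>m. is_max
           {\<mu>. lower_expectation \<Q> \<M> (u \<union> v)
                 (\<lambda>x. output_prob K u B (restrict x u) * (f (restrict x v) - \<mu>)) \<ge> 0} m
         \<and> updated_lower_expectation (icthmc \<Q> \<M> K) v f u B = ereal m"
proof -
  have u: "finite u" "u \<subseteq> {0..}" and v: "finite v" "v \<subseteq> {0..}"
    using assms(8,9) by (auto simp: time_sets_def)
  define g where "g = (\<lambda>x. output_prob K u B (restrict x u))"
  define h where "h = (\<lambda>x. f (restrict x v))"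
  define p where "p = (\<lambda>P. expectation P (u \<union> v) g)"
  define n where "n = (\<lambda>P. expectation P (u \<union> v) (\<lambda>x. g x * h x))"
  have g0: "g x \<ge> 0" for x
    unfolding g_def using assms(7,10) by (rule output_prob_nonneg)
  have sp: "stochastic_process P" if "P \<in> ictmc \<Q> \<M>" for P
    using that by (simp add: ictmc_def)
  have P0: "P (state_event (u \<union> v) x) paths \<ge> 0" if "P \<in> ictmc \<Q> \<M>" for P x
    using stochastic_process_nonneg[OF sp[OF that]] u v by simp
  have p: "prob_output (augment K P) u B = p P" if "P \<in> ictmc \<Q> \<M>" for P
    unfolding p_def g_def prob_output_augment
    using u v by (intro expectation_restrict[symmetric] sp that) auto
  have p0: "p P \<ge> 0" if "P \<in> ictmc \<Q> \<M>" for P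
    unfolding p_def expectation_def by (intro sum_nonneg mult_nonneg_nonneg g0 P0 that)
  have n0: "n P = 0" if "P \<in> ictmc \<Q> \<M>" "p P = 0" for P
    unfolding n_def using u v that P0 g0 by (intro expectation_eq_0_mult) (auto simp: p_def)
  have upd: "updated_expectation (augment K P) v f u B = n P / p P" if "P \<in> ictmc \<Q> \<M>" for P
    unfolding updated_expectation_augment[OF u(1) v(1)] p[OF that] by (simp add: n_def g_def h_def)
  define I where "I = (INF P\<in>{P \<in> ictmc \<Q> \<M>. p P > 0}. ereal (n P / p P))"
  have I: "updated_lower_expectation (icthmc \<Q> \<M> K) v f u B = I"
  proof -
    \<comment> \<open>The infimum is reindexed by the underlying processes; several of them may
      share one augmentation, which leaves the infimum unchanged.\<close>
    have "{R \<in> icthmc \<Q> \<M> K. prob_output R u B > 0} = augment K ` {P \<in> ictmc \<Q> \<M>. p P > 0}"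
      unfolding icthmc_def using p by auto
    then show ?thesis
      unfolding updated_lower_expectation_def I_def
      by (simp add: image_image, intro INF_cong) (simp_all add: upd)
  qed
  have S: "lower_expectation \<Q> \<M> (u \<union> v)
             (\<lambda>x. output_prob K u B (restrict x u) * (f (restrict x v) - \<mu>)) \<ge> 0 \<longleftrightarrow> ereal \<mu> \<le> I" for \<mu>
  proof -
    \<comment> \<open>If \<open>p P = 0\<close>, then \<open>n P = 0\<close> makes the left side
      true and the right side is vacuous; otherwise divide by \<open>p P > 0\<close>.\<close>
    have "(0 \<le> n P - \<mu> * p P) \<longleftrightarrow> (p P > 0 \<longrightarrow> \<mu> \<le> n P / p P)" if "P \<in> ictmc \<Q> \<M>" for P
      using p0[OF that] n0[OF that] by (cases "p P = 0") (auto simp: field_simps)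
    then show ?thesis
      unfolding lower_expectation_def I_def le_INF_iff
      by (auto simp: n_def p_def g_def h_def expectation_diff_scaled)
  qed
  \<comment> \<open>A positive supremum is witnessed by some process, so the infimum
    \<open>I\<close> runs over a non-empty set and is not plus infinity.\<close>
  obtain P where P: "P \<in> ictmc \<Q> \<M>" "p P > 0"
    using assms(11) p unfolding upper_prob_output_def icthmc_def
    by (auto simp: less_SUP_iff)
  then have upper: "I \<le> ereal (n P / p P)"
    unfolding I_def by (intro INF_lower) auto
  have fin: "finite (f ` assignments v)"
    using v by (simp add: finite_assignments)
  have "ereal (Min (f ` assignments v)) \<le> I"
    unfolding I_def
  proof (rule INF_greatest, clarify)
    fix P assume P: "P \<in> ictmc \<Q> \<M>" "p P > 0"
    have "Min (f ` assignments v) * p P \<le> n P"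
      unfolding n_def p_def
    proof (intro expectation_mult_ge g0 P0 P)
      fix x :: "real \<Rightarrow> 'x"
      \<comment> \<open>Holds for every function \<open>x\<close>, so the minimum over
        \<open>assignments v\<close> bounds \<open>h\<close> everywhere.\<close>
      have "restrict x v \<in> assignments v" by (simp add: assignments_def)
      then show "Min (f ` assignments v) \<le> h x"
        unfolding h_def by (intro Min_le fin imageI)
    qed
    with P show "ereal (Min (f ` assignments v)) \<le> ereal (n P / p P)"
      by (simp add: field_simps)
  qed
  with upper obtain m where "I = ereal m"
    by (cases I) auto
  \<comment> \<open>By \<open>S\<close> the constraint set is the closed half-line of reals up to
    \<open>m\<close>, which attains its maximum at \<open>m\<close>.\<close>
  then show ?thesis
    unfolding is_max_def S I by auto
qed

end
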